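(* Let $H$ be an arbitrary graph. Then any online algorithm with advice for the Delayed $H$-Node-Deletion Problem requires $\mathrm{opt} \cdot \log |H|$ bits of advice to be optimal.
   Context: Graphs are finite, simple, undirected, with at least one vertex (the graph left after deletions may be empty). $|G|$ is the number of vertices of $G$; $\log$ is base 2. A graph $G$ is $H$-free if $H$ is not isomorphic to an induced subgraph of $G$. Delayed $H$-Node-Deletion Problem: $H$ is a fixed graph. An instance is a graph $G$ with an ordering $v_1,\dots,v_n$ of its vertices. In step $i$, vertex $v_i$ and its adjacencies to $v_1,\dots,v_{i-1}$ are revealed, and the algorithm (not knowing the future vertices or $n$) must output $S_i\subseteq\{v_1,\dots,v_i\}$ such that $G[\{v_1,\dots,v_i\}]-S_i$ is $H$-free; moreover $S_1\subseteq\dots\subseteq S_n$. The goal is to minimize $|S_n|$. For an instance, $\mathrm{opt}$ is the minimum size of a set $S\subseteq V(G)$ with $G-S$ $H$-free. An online algorithm with advice is deterministic, and additionally may sequentially read bits from an infinite binary tape. It is optimal if for every instance $I$ there is a tape content $\phi_I$ (chosen by an oracle knowing $I$) with which it outputs a solution of size $\mathrm{opt}(I)$ on $I$. "Requires $b(\mathrm{opt})$ bits of advice to be optimal" means: for every optimal online algorithm with advice, every choice of such tape contents $\phi_I$, and every integer $k\ge 1$, there is an instance $I$ with $\mathrm{opt}(I)=k$ on which the algorithm, run with $\phi_I$, reads at least $b(k)$ bits of the tape. *)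

theory Defs
  imports Complex_Main "HOL-Library.Stream" "Graph_Theory.Graph_Theory"
begin

text \<open>
  A finite simple undirected graph is a value satisfying \<^locale>\<open>pair_graph\<close>: the two directions
  of an edge are both present as arcs. The graphs obtained from it by restriction live in
  \<^typ>\<open>('a, 'a \<times> 'a) pre_digraph\<close>, the target of \<^const>\<open>with_proj\<close>.
\<close>

definition H_free :: "'a pair_pre_digraph \<Rightarrow> ('b, 'b \<times> 'b) pre_digraph \<Rightarrow> bool" where
  "H_free H G \<longleftrightarrow> \<not> (\<exists>K. induced_subgraph K G \<and> digraph_iso (with_proj H) K)"

definition opt :: "'a pair_pre_digraph \<Rightarrow> 'b pair_pre_digraph \<Rightarrow> nat" where
  "opt H G = (LEAST m. \<exists>S \<subseteq> pverts G. card S = m \<and> H_free H (with_proj G \<restriction> (pverts G - S)))"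

text \<open>Vertices are named by natural numbers; the list is the order in which they are revealed.\<close>

definition online_instance :: "nat pair_pre_digraph \<Rightarrow> nat list \<Rightarrow> bool" where
  "online_instance G vs \<longleftrightarrow>
     pair_graph G \<and> pverts G \<noteq> {} \<and> distinct vs \<and> set vs = pverts G"

definition revealed :: "nat pair_pre_digraph \<Rightarrow> nat list \<Rightarrow> nat \<Rightarrow> (nat, nat \<times> nat) pre_digraph" where
  "revealed G vs i = with_proj G \<restriction> set (take i vs)"

definition valid_solution ::
    "'a pair_pre_digraph \<Rightarrow> nat pair_pre_digraph \<Rightarrow> nat list \<Rightarrow> (nat \<Rightarrow> nat set) \<Rightarrow> bool" where
  "valid_solution H G vs S \<longleftrightarrow>
     (\<forall>i \<in> {1..length vs}. S i \<subseteq> set (take i vs) \<and>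
        H_free H (revealed G vs i \<restriction> (set (take i vs) - S i))) \<and>
     (\<forall>i \<in> {1..<length vs}. S i \<subseteq> S (Suc i))"

text \<open>
  An algorithm repeatedly maps what it has seen so far (the revealed graph, the revealed vertices
  in order, and the tape bits already read) to its next action: read one more bit, or answer the
  current step, upon which the next vertex is revealed. Earlier answers, and the step in which a
  bit was read, can be recomputed from these arguments, so this loses no generality.
\<close>

datatype action = Read_Bit | Answer "nat set"

type_synonym advice_alg =
  "(nat, nat \<times> nat) pre_digraph \<Rightarrow> nat list \<Rightarrow> bool list \<Rightarrow> action"

text \<open>
  \<open>r i\<close> is the total number of bits read up to the end of step \<open>i\<close>, and \<open>S i\<close> is the answer given
  in step \<open>i\<close>. No such \<open>r\<close> and \<open>S\<close> exist if the algorithm keeps reading forever in some step.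
\<close>

definition alg_run ::
    "advice_alg \<Rightarrow> nat pair_pre_digraph \<Rightarrow> nat list \<Rightarrow> bool stream \<Rightarrow>
     (nat \<Rightarrow> nat) \<Rightarrow> (nat \<Rightarrow> nat set) \<Rightarrow> bool" where
  "alg_run A G vs \<phi> r S \<longleftrightarrow> r 0 = 0 \<and>
     (\<forall>i \<in> {1..length vs}. r (i - 1) \<le> r i \<and>
        (\<forall>j \<in> {r (i - 1)..<r i}. A (revealed G vs i) (take i vs) (stake j \<phi>) = Read_Bit) \<and>
        A (revealed G vs i) (take i vs) (stake (r i) \<phi>) = Answer (S i))"

definition reads_bits ::
    "advice_alg \<Rightarrow> nat pair_pre_digraph \<Rightarrow> nat list \<Rightarrow> bool stream \<Rightarrow> nat \<Rightarrow> bool" where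
  "reads_bits A G vs \<phi> b \<longleftrightarrow> (\<exists>r S. alg_run A G vs \<phi> r S \<and> r (length vs) = b)"

lemma alg_run_unique:
  assumes "alg_run A G vs \<phi> r S" "alg_run A G vs \<phi> r' S'" "i \<le> length vs"
  shows "r i = r' i \<and> (i \<noteq> 0 \<longrightarrow> S i = S' i)"
  using assms(3)
proof (induction i)
  case 0
  then show ?case using assms(1,2) by (simp add: alg_run_def)
next
  case (Suc i)
  have A: "p i \<le> p (Suc i)"
      "\<And>j. p i \<le> j \<Longrightarrow> j < p (Suc i) \<Longrightarrow>
         A (revealed G vs (Suc i)) (take (Suc i) vs) (stake j \<phi>) = Read_Bit"
      "A (revealed G vs (Suc i)) (take (Suc i) vs) (stake (p (Suc i)) \<phi>) = Answer (Q (Suc i))"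
    if "alg_run A G vs \<phi> p Q" for p Q
    using that Suc.prems unfolding alg_run_def by (auto dest!: bspec[where x = "Suc i"])
  have "r i = r' i" using Suc by simp
  then have "r (Suc i) = r' (Suc i)"
    using A[OF assms(1)] A[OF assms(2)] by (metis action.distinct(1) linorder_neqE_nat)
  then show ?case using A(3)[OF assms(1)] A(3)[OF assms(2)] by simp
qed

lemma reads_bits_unique: "reads_bits A G vs \<phi> b \<Longrightarrow> reads_bits A G vs \<phi> b' \<Longrightarrow> b = b'"
  unfolding reads_bits_def using alg_run_unique by blast

definition solves_optimally ::
    "'a pair_pre_digraph \<Rightarrow> advice_alg \<Rightarrow> nat pair_pre_digraph \<Rightarrow> nat list \<Rightarrow> bool stream \<Rightarrow> bool" where
  "solves_optimally H A G vs \<phi> \<longleftrightarrow>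
     (\<exists>r S. alg_run A G vs \<phi> r S \<and> valid_solution H G vs S \<and> card (S (length vs)) = opt H G)"

definition optimal_alg :: "'a pair_pre_digraph \<Rightarrow> advice_alg \<Rightarrow> bool" where
  "optimal_alg H A \<longleftrightarrow>
     (\<forall>G vs. online_instance G vs \<longrightarrow> (\<exists>\<phi>. solves_optimally H A G vs \<phi>))"

definition requires_advice :: "'a pair_pre_digraph \<Rightarrow> (nat \<Rightarrow> real) \<Rightarrow> bool" where
  "requires_advice H b \<longleftrightarrow>
     (\<forall>A \<phi>. optimal_alg H A \<longrightarrow>
        (\<forall>G vs. online_instance G vs \<longrightarrow> solves_optimally H A G vs (\<phi> G vs)) \<longrightarrow>
        (\<forall>k \<ge> 1. \<exists>G vs n. online_instance G vs \<and> opt H G = k \<and>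
           reads_bits A G vs (\<phi> G vs) n \<and> real n \<ge> b k))"

end

theory Submission
  imports Defs
begin

text \<open>
  Either \<open>H\<close> or its complement is connected; put \<open>d = False\<close> or \<open>d = True\<close> accordingly. Reveal
  \<open>k\<close> copies of \<open>H\<close>, then glue onto each of them a second copy that shares a single vertex, chosen
  freely among the \<open>|H|\<close> vertices of the first; two vertices in no common copy are adjacent iff \<open>d\<close>.
  The set of shared vertices is the only optimal solution: it hits all copies, and once it is
  deleted, an induced copy of \<open>H\<close> would by connectedness have to fit into one of the remaining
  parts, which have only \<open>|H| - 1\<close> vertices. An optimal algorithm has deleted this whole set when
  the first copies are complete, so there the \<open>|H| ^ k\<close> instances look the same but demand
  different answers: no two of them can be served with the same advice.
\<close>

section \<open>Induced copies as vertex embeddings\<close>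

text \<open>An isomorphism in the sense of \<open>digraph_iso\<close> also carries a map on arcs.
  Since arcs are pairs with projections \<open>fst\<close> and \<open>snd\<close>, the vertex map
  determines it, and only an injection preserving both adjacency and non-adjacency remains.\<close>

lemma H_free_induce_iff:
  assumes H: "pair_wf_digraph H" and G: "pair_wf_digraph G"
  shows "H_free H (with_proj G \<restriction> W) \<longleftrightarrow>
    \<not> (\<exists>f. inj_on f (pverts H) \<and> f ` pverts H \<subseteq> W \<and>
      (\<forall>u \<in> pverts H. \<forall>v \<in> pverts H. (u, v) \<in> parcs H \<longleftrightarrow> (f u, f v) \<in> parcs G))"
    (is "_ \<longleftrightarrow> \<not> (\<exists>f. ?emb f)")
proof -
  interpret H: pair_wf_digraph H by fact
  interpret G: pair_wf_digraph G by fact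
  have wfW: "wf_digraph (with_proj G \<restriction> W)"
    by (rule G.wellformed_induce_subgraph)
  have emb: "\<exists>f. ?emb f" if K: "induced_subgraph K (with_proj G \<restriction> W)" "digraph_iso (with_proj H) K" for K
  proof -
    obtain m where m: "H.digraph_isomorphism m" and Km: "K = app_iso m (with_proj H)"
      using K(2) unfolding digraph_iso_def by blast
    have inj: "inj_on (iso_verts m) (pverts H)"
      and ends: "\<And>a. a \<in> parcs H \<Longrightarrow> iso_verts m (fst a) = iso_tail m (iso_arcs m a) \<and>
          iso_verts m (snd a) = iso_head m (iso_arcs m a)"
      using m unfolding H.digraph_isomorphism_def by auto
    have vK: "verts K = iso_verts m ` pverts H" "arcs K = iso_arcs m ` parcs H"
      "tail K = iso_tail m" "head K = iso_head m" by (simp_all add: Km)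
    have sub: "verts K \<subseteq> W" and tails: "tail K = fst" "head K = snd"
      and arcsK: "arcs K = {e \<in> parcs G. fst e \<in> verts K \<and> snd e \<in> verts K}"
      using K(1) unfolding induced_subgraph_def subgraph_def compatible_def by auto
    have arc: "iso_arcs m a = (iso_verts m (fst a), iso_verts m (snd a))" if "a \<in> parcs H" for a
      using ends[OF that] tails vK by (simp add: prod_eq_iff)
    have "(u, v) \<in> parcs H \<longleftrightarrow> (iso_verts m u, iso_verts m v) \<in> parcs G"
      if uv: "u \<in> pverts H" "v \<in> pverts H" for u v
    proof
      assume "(u, v) \<in> parcs H"
      then have "iso_arcs m (u, v) \<in> arcs K" "iso_arcs m (u, v) = (iso_verts m u, iso_verts m v)"
        using vK arc[of "(u, v)"] by (metis imageI, simp)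
      then show "(iso_verts m u, iso_verts m v) \<in> parcs G" using arcsK by auto
    next
      assume "(iso_verts m u, iso_verts m v) \<in> parcs G"
      then have "(iso_verts m u, iso_verts m v) \<in> iso_arcs m ` parcs H"
        using arcsK vK uv by auto
      then obtain a where a: "a \<in> parcs H" "iso_arcs m a = (iso_verts m u, iso_verts m v)" by force
      then have "iso_verts m (fst a) = iso_verts m u" "iso_verts m (snd a) = iso_verts m v"
        using arc by auto
      then have "a = (u, v)"
        using inj uv a(1) H.arc_fst_in_verts H.arc_snd_in_verts by (simp add: inj_on_eq_iff prod_eq_iff)
      then show "(u, v) \<in> parcs H" using a by simp
    qed
    then show ?thesis using inj sub vK by (intro exI[of _ "iso_verts m"]) auto
  qed
  have copy: "\<exists>K. induced_subgraph K (with_proj G \<restriction> W) \<and> digraph_iso (with_proj H) K"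
    if f: "?emb f" for f
  proof -
    let ?m = "\<lparr>iso_verts = f, iso_arcs = map_prod f f, iso_head = snd, iso_tail = fst\<rparr>"
    let ?K = "app_iso ?m (with_proj H)"
    have "inj_on (map_prod f f) (parcs H)"
    proof (rule inj_on_subset[OF map_prod_inj_on])
      show "inj_on f (pverts H)" "inj_on f (pverts H)" using f by blast+
      show "parcs H \<subseteq> pverts H \<times> pverts H" using H.in_arcsD1 H.in_arcsD2 by auto
    qed
    then have m: "H.digraph_isomorphism ?m"
      using f unfolding H.digraph_isomorphism_def by (auto intro: H.wf_digraph_axioms)
    have aK: "arcs ?K = {e \<in> parcs G. fst e \<in> f ` pverts H \<and> snd e \<in> f ` pverts H}"
    proof (intro equalityI subsetI)
      fix e assume "e \<in> arcs ?K"
      then obtain u v where "(u, v) \<in> parcs H" "e = (f u, f v)" by auto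
      moreover from this have "u \<in> pverts H" "v \<in> pverts H"
        using H.in_arcsD1 H.in_arcsD2 by auto
      ultimately show "e \<in> {e \<in> parcs G. fst e \<in> f ` pverts H \<and> snd e \<in> f ` pverts H}"
        using f by simp
    next
      fix e assume "e \<in> {e \<in> parcs G. fst e \<in> f ` pverts H \<and> snd e \<in> f ` pverts H}"
      then obtain u v where uv: "u \<in> pverts H" "v \<in> pverts H" "e = (f u, f v)" "e \<in> parcs G"
        by (cases e) auto
      then have "(u, v) \<in> parcs H" using f by simp
      then have "e \<in> map_prod f f ` parcs H" by (rule image_eqI[rotated]) (simp add: uv)
      then show "e \<in> arcs ?K" by simp
    qed
    have "wf_digraph ?K" using m by (rule H.wf_digraphI_app_iso)
    moreover have "f ` pverts H \<subseteq> W" using f by blast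
    ultimately have "induced_subgraph ?K (with_proj G \<restriction> W)"
      using aK wfW unfolding induced_subgraph_def subgraph_def compatible_def by auto
    then show ?thesis using m unfolding digraph_iso_def by blast
  qed
  have "(\<exists>K. induced_subgraph K (with_proj G \<restriction> W) \<and> digraph_iso (with_proj H) K) \<longleftrightarrow> (\<exists>f. ?emb f)"
    by (rule iffI, elim exE conjE, erule (1) emb, erule exE, erule copy)
  then show ?thesis by (simp only: H_free_def)
qed

lemma induce_subgraph_induce: "A \<subseteq> B \<Longrightarrow> (G \<restriction> B) \<restriction> A = G \<restriction> A"
  by (auto simp: induce_subgraph_def)

section \<open>Connectedness of a graph or its complement\<close>

text \<open>If both choices of \<open>d\<close> fail, some cut \<open>X\<close> of \<open>V\<close>
  has all its crossing pairs related and some cut \<open>Y\<close> has none related. A pair with one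
  point in \<open>X - Y\<close> and the other in \<open>Y - X\<close> crosses both cuts, which is
  absurd.\<close>

lemma connected_or_complement_connected:
  fixes R :: "'a \<Rightarrow> 'a \<Rightarrow> bool"
  assumes sym: "\<And>x y. R x y \<Longrightarrow> R y x"
  shows "\<exists>d. \<forall>X. X \<subseteq> V \<longrightarrow> X \<noteq> {} \<longrightarrow> X \<noteq> V \<longrightarrow> (\<exists>x \<in> X. \<exists>y \<in> V - X. R x y \<noteq> d)"
proof (rule ccontr)
  assume "\<not> ?thesis"
  then have no: "\<exists>X. X \<subseteq> V \<and> X \<noteq> {} \<and> X \<noteq> V \<and> (\<forall>x \<in> X. \<forall>y \<in> V - X. R x y = d)" for d
    by metis
  obtain X where X: "X \<subseteq> V" "X \<noteq> {}" "X \<noteq> V" "\<And>x y. x \<in> X \<Longrightarrow> y \<in> V - X \<Longrightarrow> R x y"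
    using no[of True] by auto
  obtain Y where Y: "Y \<subseteq> V" "Y \<noteq> {}" "Y \<noteq> V" "\<And>x y. x \<in> Y \<Longrightarrow> y \<in> V - Y \<Longrightarrow> \<not> R x y"
    using no[of False] by auto
  show False
  proof (cases "X \<inter> Y = {}")
    case True
    then obtain x y where "x \<in> X" "y \<in> Y" "x \<notin> Y" "y \<notin> X" using X Y by blast
    then show False using X(1) Y(1) X(4)[of x y] Y(4)[of y x] sym[of x y] by blast
  next
    case False
    \<comment> \<open>A point in both sets and a point of \<open>V\<close> in neither would form a
      pair crossing both cuts.\<close>
    then have "V \<subseteq> X \<union> Y" using X(4) Y(4) by blast
    then obtain x y where "x \<in> X" "y \<in> Y" "x \<notin> Y" "y \<notin> X"
      using X(1,3) Y(1,3) by blast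
    then show False using X(1) Y(1) X(4)[of x y] Y(4)[of y x] sym[of x y] by blast
  qed
qed

section \<open>Runs on a common prefix\<close>

text \<open>An action depends only on what is revealed and on the bits read. Hence a run survives
  shortening the instance to a prefix, changing the graph beyond it, and changing the tape beyond
  the bits read. This brings runs on different instances and tapes together.\<close>

lemma alg_run_transfer:
  assumes run: "alg_run A G vs \<phi> r S"
    and len: "length vs' \<le> length vs"
    and eq: "\<And>i. i \<le> length vs' \<Longrightarrow> take i vs' = take i vs"
      "\<And>i. i \<le> length vs' \<Longrightarrow> revealed G' vs' i = revealed G vs i"
    and tape: "stake (r (length vs)) \<psi> = stake (r (length vs)) \<phi>"
  shows "alg_run A G' vs' \<psi> r S"
proof -
  have mono: "r i \<le> r j" if "i \<le> j" "j \<le> length vs" for i j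
    using that
  proof (induction j)
    case (Suc j)
    have "r j \<le> r (Suc j)" using run Suc.prems(2) unfolding alg_run_def
      by (auto dest!: bspec[where x = "Suc j"])
    then show ?case using Suc by (cases "i = Suc j") auto
  qed simp
  have st: "stake j \<psi> = stake j \<phi>" if "j \<le> r i" "i \<le> length vs" for i j
  proof -
    have "j \<le> r (length vs)" using that mono[of i "length vs"] by simp
    then have "stake j \<xi> = take j (stake (r (length vs)) \<xi>)" for \<xi> :: "bool stream"
      by (simp add: take_stake min_def)
    then show ?thesis using tape by simp
  qed
  have "r (i - 1) \<le> r i \<and>
        (\<forall>j \<in> {r (i - 1)..<r i}. A (revealed G' vs' i) (take i vs') (stake j \<psi>) = Read_Bit) \<and>
        A (revealed G' vs' i) (take i vs') (stake (r i) \<psi>) = Answer (S i)"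
    if i: "i \<in> {1..length vs'}" for i
    using run i len eq[of i] st[of _ i] unfolding alg_run_def by auto
  then show ?thesis using run unfolding alg_run_def by blast
qed

lemma valid_solution_mono:
  assumes "valid_solution H G vs S" "1 \<le> i" "i \<le> j" "j \<le> length vs"
  shows "S i \<subseteq> S j"
  using assms(3,4)
proof (induction j rule: dec_induct)
  case (step j)
  then have "S j \<subseteq> S (Suc j)" using assms(1,2) unfolding valid_solution_def by auto
  then show ?case using step by auto
qed simp

section \<open>The glued graphs\<close>

text \<open>\<open>cut\<close> says that \<open>H\<close> (for \<open>d = False\<close>) or its
  complement (for \<open>d = True\<close>) is connected. In this form it applies directly to the set
  of vertices that an embedding sends to one row, where the row of \<open>u\<close> is
  \<open>u div h\<close> and its role is \<open>u mod h\<close>.\<close>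

locale gluing =
  fixes H :: "'a pair_pre_digraph" and g :: "nat \<Rightarrow> 'a" and h k :: nat and d :: bool
  assumes H: "pair_graph H"
    and g: "bij_betw g {..<h} (pverts H)"
    and h_pos: "0 < h"
    and cut: "\<And>X. X \<subseteq> pverts H \<Longrightarrow> X \<noteq> {} \<Longrightarrow> X \<noteq> pverts H \<Longrightarrow>
      \<exists>x \<in> X. \<exists>y \<in> pverts H - X. ((x, y) \<in> parcs H) \<noteq> d"
begin

text \<open>
  Vertex \<open>i * h + a\<close> plays the role of \<open>g a\<close> in the \<open>i\<close>-th copy of \<open>H\<close>, except that copy \<open>k + j\<close>
  borrows its vertex in the role of \<open>g (c j)\<close> from copy \<open>j\<close>.
\<close>

definition row :: "(nat \<Rightarrow> nat) \<Rightarrow> nat \<Rightarrow> nat \<Rightarrow> nat" where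
  "row c i a = (if k \<le> i \<and> a = c (i - k) then i - k else i)"

definition copy :: "(nat \<Rightarrow> nat) \<Rightarrow> nat \<Rightarrow> nat set" where
  "copy c i = {u. u div h = row c i (u mod h)}"

text \<open>A vertex has the same role \<open>u mod h\<close> in every copy containing it, so
  adjacency inside a copy need not mention which copy it is.\<close>

definition glued :: "(nat \<Rightarrow> nat) \<Rightarrow> nat pair_pre_digraph" where
  "glued c = \<lparr>pverts = (\<Union>i<2 * k. copy c i),
    parcs = {(u, v). u \<noteq> v \<and> u \<in> (\<Union>i<2 * k. copy c i) \<and> v \<in> (\<Union>i<2 * k. copy c i) \<and>
      (if \<exists>i<2 * k. u \<in> copy c i \<and> v \<in> copy c i then (g (u mod h), g (v mod h)) \<in> parcs H
       else d)}\<rparr>"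

text \<open>The first copies occupy exactly the numbers below \<open>k * h\<close>, so increasing
  order reveals them before anything else.\<close>

definition order :: "(nat \<Rightarrow> nat) \<Rightarrow> nat list" where
  "order c = filter (\<lambda>u. u \<in> pverts (glued c)) [0..<2 * k * h]"

definition glue_points :: "(nat \<Rightarrow> nat) \<Rightarrow> nat set" where
  "glue_points c = (\<lambda>j. j * h + c j) ` {..<k}"

lemma copy_first: "i < k \<Longrightarrow> copy c i = {u. u div h = i}"
  by (auto simp: copy_def row_def)

lemma pverts_glued_less: "u \<in> pverts (glued c) \<Longrightarrow> u < 2 * k * h"
proof -
  assume "u \<in> pverts (glued c)"
  then have "u div h < 2 * k"
    by (auto simp: glued_def copy_def row_def split: if_splits)
  then show ?thesis using h_pos by (simp add: div_less_iff_less_mult)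
qed

lemma first_copies_in_glued: "u < k * h \<Longrightarrow> u \<in> pverts (glued c)"
proof -
  assume "u < k * h"
  then have "u div h < k" by (simp add: less_mult_imp_div_less)
  then show ?thesis by (auto simp: glued_def copy_first intro!: bexI[of _ "u div h"])
qed

lemma pair_graph_glued: "pair_graph (glued c)"
proof -
  have "finite (pverts (glued c))"
    by (rule finite_subset[of _ "{..<2 * k * h}"]) (auto dest: pverts_glued_less)
  moreover have "parcs (glued c) \<subseteq> pverts (glued c) \<times> pverts (glued c)"
    by (auto simp: glued_def)
  ultimately have fin: "finite (pverts (glued c))" "finite (parcs (glued c))"
    by (auto intro: finite_subset)
  have symH: "(x, y) \<in> parcs H \<longleftrightarrow> (y, x) \<in> parcs H" for x y
    using pair_sym_digraph.pair_sym_arcs[of H] H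
    by (auto simp: symmetric_def sym_def pair_graph_def pair_pseudo_graph_def)
  show ?thesis
    by unfold_locales
      (use fin symH in \<open>auto simp: glued_def symmetric_def sym_def split: if_splits\<close>)
qed

lemma wf_glued: "pair_wf_digraph (glued c)"
  using pair_graph_glued[of c] by (simp add: pair_graph_def pair_digraph_def pair_fin_digraph_def)

lemma wf_H: "pair_wf_digraph H"
  using H by (simp add: pair_graph_def pair_digraph_def pair_fin_digraph_def)

lemma no_loop_H: "(x, x) \<notin> parcs H"
  using H pair_loopfree_digraph.pair_no_loops[of H "(x, x)"]
  by (auto simp: pair_graph_def pair_digraph_def)

lemma set_order: "set (order c) = pverts (glued c)"
  by (auto simp: order_def dest: pverts_glued_less)

lemma order_prefix: "order c = [0..<k * h] @ filter (\<lambda>u. u \<in> pverts (glued c)) [k * h..<2 * k * h]"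
proof -
  have "[0..<2 * k * h] = [0..<k * h] @ [k * h..<2 * k * h]"
    using upt_add_eq_append[of 0 "k * h" "k * h"] by (simp add: mult_2 distrib_right)
  then show ?thesis by (auto simp: order_def first_copies_in_glued)
qed

lemma online_instance_glued:
  assumes "1 \<le> k"
  shows "online_instance (glued c) (order c)"
proof -
  have "0 \<in> pverts (glued c)" using assms h_pos by (intro first_copies_in_glued) simp
  then show ?thesis
    using pair_graph_glued set_order by (auto simp: online_instance_def order_def)
qed

text \<open>Sending each \<open>x\<close> to the vertex of copy \<open>i\<close> in its role embeds
  \<open>H\<close>: any two images share copy \<open>i\<close>, so their adjacency is read off
  \<open>H\<close>.\<close>

lemma H_free_not_copy_subset:
  assumes free: "H_free H (with_proj (glued c) \<restriction> W)" and i: "i < 2 * k"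
  shows "\<not> copy c i \<subseteq> W"
proof
  assume W: "copy c i \<subseteq> W"
  define lab where "lab = the_inv_into {..<h} g"
  define f where "f x = row c i (lab x) * h + lab x" for x
  have lab: "lab x < h" "g (lab x) = x" if "x \<in> pverts H" for x
    using that g the_inv_into_into[of g "{..<h}" x "{..<h}"] f_the_inv_into_f[of g "{..<h}" x]
    by (auto simp: lab_def bij_betw_def)
  have mod_f: "f x mod h = lab x" "f x div h = row c i (lab x)" if "x \<in> pverts H" for x
    using lab[OF that] by (simp_all add: f_def)
  have in_copy: "f x \<in> copy c i" if "x \<in> pverts H" for x
    using mod_f[OF that] by (simp add: copy_def)
  have inj: "inj_on f (pverts H)"
    by (rule inj_onI) (metis mod_f(1) lab(2))
  have arc: "(u, v) \<in> parcs H \<longleftrightarrow> (f u, f v) \<in> parcs (glued c)"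
    if "u \<in> pverts H" "v \<in> pverts H" for u v
  proof (cases "u = v")
    case True
    then show ?thesis by (simp add: no_loop_H glued_def)
  next
    case False
    then have "f u \<noteq> f v" using inj that by (simp add: inj_on_eq_iff)
    then show ?thesis using i in_copy that by (auto simp: glued_def mod_f lab)
  qed
  have "f ` pverts H \<subseteq> W" using in_copy W by blast
  then show False using free inj arc unfolding H_free_induce_iff[OF wf_H wf_glued] by blast
qed

section \<open>Optimal solutions of a glued graph\<close>

context
  fixes c :: "nat \<Rightarrow> nat"
  assumes c: "\<And>j. j < k \<Longrightarrow> c j < h"
begin

lemma glue_point_div_mod: "j < k \<Longrightarrow> (j * h + c j) div h = j \<and> (j * h + c j) mod h = c j"
  using c[of j] by simp

lemma card_glue_points: "card (glue_points c) = k"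
proof -
  have "inj_on (\<lambda>j. j * h + c j) {..<k}"
  proof (rule inj_onI)
    fix i j assume "i \<in> {..<k}" "j \<in> {..<k}" "i * h + c i = j * h + c j"
    then show "i = j" using glue_point_div_mod by (metis lessThan_iff)
  qed
  then show ?thesis by (simp add: glue_points_def card_image)
qed

lemma glue_points_iff: "u \<in> glue_points c \<longleftrightarrow> u div h < k \<and> u mod h = c (u div h)"
proof
  assume u: "u div h < k \<and> u mod h = c (u div h)"
  then have "u = u div h * h + c (u div h)" using div_mult_mod_eq[of u h] by simp
  then show "u \<in> glue_points c" using u unfolding glue_points_def by blast
next
  assume "u \<in> glue_points c"
  then obtain j where "j < k" "u = j * h + c j" by (auto simp: glue_points_def)
  then show "u div h < k \<and> u mod h = c (u div h)" using glue_point_div_mod[of j] by metis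
qed

lemma glue_points_subset: "glue_points c \<subseteq> pverts (glued c)"
proof
  fix u assume "u \<in> glue_points c"
  then have "u < k * h" using h_pos by (simp add: glue_points_iff div_less_iff_less_mult)
  then show "u \<in> pverts (glued c)" by (rule first_copies_in_glued)
qed

text \<open>Each remaining vertex lies in one copy only, that of its row, and vertices in different
  rows have adjacency \<open>d\<close>. By \<open>cut\<close> an embedded \<open>H\<close> stays in
  one row, and there one role is missing.\<close>

lemma H_free_minus_glue_points:
  "H_free H (with_proj (glued c) \<restriction> (pverts (glued c) - glue_points c))"
  unfolding H_free_induce_iff[OF wf_H wf_glued]
proof
  let ?V = "pverts H"
  assume "\<exists>f. inj_on f ?V \<and> f ` ?V \<subseteq> pverts (glued c) - glue_points c \<and>
      (\<forall>u \<in> ?V. \<forall>v \<in> ?V. (u, v) \<in> parcs H \<longleftrightarrow> (f u, f v) \<in> parcs (glued c))"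
  then obtain f where inj: "inj_on f ?V" and im: "f ` ?V \<subseteq> pverts (glued c) - glue_points c"
    and arc: "\<And>u v. u \<in> ?V \<Longrightarrow> v \<in> ?V \<Longrightarrow> (u, v) \<in> parcs H \<longleftrightarrow> (f u, f v) \<in> parcs (glued c)"
    by blast
  have copyD: "u div h = i" if "u \<in> copy c i" "i < 2 * k" "u \<notin> glue_points c" for u i
    using that by (auto simp: copy_def row_def glue_points_iff split: if_splits)
  have card_V: "card ?V = h" using bij_betw_same_card[OF g] by simp
  then have "?V \<noteq> {}" using h_pos by auto
  then obtain x0 where x0: "x0 \<in> ?V" by blast
  define i where "i = f x0 div h"
  \<comment> \<open>Were \<open>X\<close> a proper subset, \<open>cut\<close> would give a pair
    across it with adjacency other than \<open>d\<close>, although its images lie in different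
    rows.\<close>
  define X where "X = {x \<in> ?V. f x div h = i}"
  have "X = ?V"
  proof (rule ccontr)
    assume "X \<noteq> ?V"
    moreover have "X \<subseteq> ?V" "X \<noteq> {}" using x0 by (auto simp: X_def i_def)
    ultimately obtain x y where xy: "x \<in> X" "y \<in> ?V - X" "((x, y) \<in> parcs H) \<noteq> d"
      using cut[of X] by blast
    then have ne: "f x div h \<noteq> f y div h" and V: "x \<in> ?V" "y \<in> ?V" by (auto simp: X_def)
    have "f x \<in> pverts (glued c) - glue_points c" "f y \<in> pverts (glued c) - glue_points c"
      using im V by auto
    then have "(f x, f y) \<in> parcs (glued c) \<longleftrightarrow> d"
      using ne copyD by (auto simp: glued_def)
    then show False using xy(3) arc[OF V] by simp
  qed
  then have rows: "f x div h = i" if "x \<in> ?V" for x using that by (auto simp: X_def)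
  \<comment> \<open>The role missing from row \<open>i\<close>: that of the deleted glue point for a
    first copy, that of the borrowed vertex for a second one.\<close>
  define a where "a = c (if k \<le> i then i - k else i)"
  have "f x0 \<in> pverts (glued c)" using x0 im by auto
  then have i: "i < 2 * k" using pverts_glued_less[of "f x0" c] by (simp add: i_def less_mult_imp_div_less)
  have "f x mod h \<in> {..<h} - {a}" if x: "x \<in> ?V" for x
  proof -
    have fx: "f x \<in> pverts (glued c)" "f x \<notin> glue_points c" using im x by auto
    then obtain j where j: "j < 2 * k" "f x \<in> copy c j" by (auto simp: glued_def)
    then have "j = i" using copyD fx rows[OF x] by blast
    then have "f x mod h \<noteq> a"
      using j fx rows[OF x] i by (auto simp: a_def copy_def row_def glue_points_iff split: if_splits)
    then show ?thesis using h_pos by simp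
  qed
  then have "(\<lambda>x. f x mod h) ` ?V \<subseteq> {..<h} - {a}" by blast
  \<comment> \<open>Within one row the role determines the vertex, so \<open>h\<close> vertices
    would need \<open>h\<close> roles where only \<open>h - 1\<close> are left.\<close>
  moreover have "inj_on (\<lambda>x. f x mod h) ?V"
  proof (rule inj_onI)
    fix x y assume "x \<in> ?V" "y \<in> ?V" "f x mod h = f y mod h"
    then have "f x = f y" using rows by (metis div_mult_mod_eq)
    then show "x = y" using inj \<open>x \<in> ?V\<close> \<open>y \<in> ?V\<close> by (simp add: inj_on_eq_iff)
  qed
  ultimately have "card ?V \<le> card ({..<h} - {a})" by (intro card_inj_on_le) auto
  moreover have "a < h" using i by (auto simp: a_def intro!: c)
  ultimately show False using card_V by simp
qed

lemma rows_of_hitting_set: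
  assumes "\<And>j. j < k \<Longrightarrow> S \<inter> copy c j \<noteq> {}"
  shows "{..<k} \<subseteq> (\<lambda>u. u div h) ` S"
proof
  fix j assume "j \<in> {..<k}"
  then have j: "j < k" by simp
  then obtain u where "u \<in> S" "u div h = j"
    using assms[OF j] unfolding copy_first[OF j] by blast
  then show "j \<in> (\<lambda>u. u div h) ` S" by blast
qed

lemma hits_copies:
  assumes "H_free H (with_proj (glued c) \<restriction> (pverts (glued c) - S))" "i < 2 * k"
  shows "S \<inter> copy c i \<noteq> {}"
proof -
  have "copy c i \<subseteq> pverts (glued c)" using assms(2) by (auto simp: glued_def)
  then show ?thesis using H_free_not_copy_subset[OF assms] by blast
qed

lemma finite_pverts_glued: "finite (pverts (glued c))"
  by (metis List.finite_set set_order)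

text \<open>The glue points attain \<open>k\<close>; the \<open>k\<close> pairwise disjoint first
  copies force at least that many deletions.\<close>

lemma opt_glued: "opt H (glued c) = k"
  unfolding opt_def
proof (rule Least_equality)
  show "\<exists>S \<subseteq> pverts (glued c). card S = k \<and> H_free H (with_proj (glued c) \<restriction> (pverts (glued c) - S))"
    using glue_points_subset card_glue_points H_free_minus_glue_points by blast
next
  fix m assume "\<exists>S \<subseteq> pverts (glued c). card S = m \<and>
    H_free H (with_proj (glued c) \<restriction> (pverts (glued c) - S))"
  then obtain S where S: "S \<subseteq> pverts (glued c)" "card S = m"
    "H_free H (with_proj (glued c) \<restriction> (pverts (glued c) - S))" by blast
  then have "finite S" using finite_pverts_glued finite_subset by blast
  moreover have "{..<k} \<subseteq> (\<lambda>u. u div h) ` S"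
    using hits_copies[OF S(3)] by (intro rows_of_hitting_set) simp
  ultimately have "card {..<k} \<le> card S" by (rule surj_card_le)
  then show "k \<le> m" using S(2) by simp
qed

text \<open>Hitting the \<open>k\<close> disjoint first copies uses up all \<open>k\<close>
  vertices, one per row below \<open>k\<close>. A second copy can then only be hit at the vertex it
  borrows.\<close>

lemma optimal_solution_unique:
  assumes S: "S \<subseteq> pverts (glued c)" "card S = k"
    and free: "H_free H (with_proj (glued c) \<restriction> (pverts (glued c) - S))"
  shows "S = glue_points c"
proof -
  have fin: "finite S" using S(1) finite_pverts_glued finite_subset by blast
  have "{..<k} \<subseteq> (\<lambda>u. u div h) ` S"
    using hits_copies[OF free] by (intro rows_of_hitting_set) simp
  \<comment> \<open>The image contains \<open>k\<close> rows and has at most \<open>k\<close>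
    elements, so \<open>S\<close> avoids every row from \<open>k\<close> on.\<close>
  then have rows: "(\<lambda>u. u div h) ` S = {..<k}"
    using fin S(2) card_image_le[OF fin, of "\<lambda>u. u div h"]
    by (intro card_seteq[symmetric]) auto
  have "glue_points c \<subseteq> S"
  proof
    fix u assume u: "u \<in> glue_points c"
    let ?j = "u div h"
    have j: "?j < k" "u mod h = c ?j" using u by (auto simp: glue_points_iff)
    obtain v where v: "v \<in> S" "v \<in> copy c (k + ?j)"
      using hits_copies[OF free, of "k + ?j"] j by auto
    moreover have "v div h < k" using v(1) rows by auto
    ultimately have "v div h = ?j" "v mod h = c ?j"
      by (auto simp: copy_def row_def split: if_splits)
    then have "v = u" using j by (metis div_mult_mod_eq)
    then show "u \<in> S" using v by simp
  qed
  then show ?thesis using card_seteq[OF fin] S(2) card_glue_points by (metis order_refl)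
qed

end

text \<open>
  The whole solution is forced by the end of step \<open>k * h\<close>, when nothing of the second copies,
  and hence nothing of \<open>c\<close>, has been revealed.
\<close>

lemma optimal_answer_first_copies:
  assumes k: "1 \<le> k" and c: "\<And>j. j < k \<Longrightarrow> c j < h"
    and valid: "valid_solution H (glued c) (order c) S"
    and card: "card (S (length (order c))) = opt H (glued c)"
  shows "S (k * h) = glue_points c"
proof -
  let ?n = "length (order c)"
  have kh: "1 \<le> k * h" "k * h \<le> ?n" using k h_pos by (simp_all add: order_prefix)
  have step: "S i \<subseteq> set (take i (order c))"
    "H_free H (with_proj (glued c) \<restriction> (set (take i (order c)) - S i))" if "i \<in> {1..?n}" for i
    using valid that unfolding valid_solution_def revealed_def
    by (auto simp: induce_subgraph_induce)
  have final: "S ?n = glue_points c"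
    using step[of ?n] kh card opt_glued[OF c] set_order
    by (intro optimal_solution_unique[OF c]) auto
  have sub: "S (k * h) \<subseteq> glue_points c"
    using valid_solution_mono[OF valid kh(1) kh(2)] final by simp
  have free: "H_free H (with_proj (glued c) \<restriction> ({..<k * h} - S (k * h)))"
    using step(2)[of "k * h"] kh by (simp add: order_prefix atLeast0LessThan)
  \<comment> \<open>\<open>S (k * h)\<close> must meet every first copy, and each of these contains
    just one glue point.\<close>
  have "glue_points c \<subseteq> S (k * h)"
  proof
    fix u assume u: "u \<in> glue_points c"
    then have j: "u div h < k" "u mod h = c (u div h)" using c by (auto simp: glue_points_iff)
    then have "copy c (u div h) \<subseteq> {..<k * h}"
      using h_pos by (auto simp: copy_first div_less_iff_less_mult[symmetric])
    then obtain v where "v \<in> S (k * h)" "v \<in> copy c (u div h)"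
      using H_free_not_copy_subset[OF free, of "u div h"] j(1) by auto
    moreover from this have "v div h = u div h" "v mod h = c (v div h)"
      using sub c j(1) by (auto simp: copy_first glue_points_iff)
    ultimately show "u \<in> S (k * h)" using j by (metis div_mult_mod_eq)
  qed
  then show ?thesis using sub by blast
qed

section \<open>Indistinguishable beginnings and counting of tapes\<close>

text \<open>A second copy contains at most one vertex below \<open>k * h\<close>. So two distinct
  vertices there share a copy iff they are in the same row, whatever \<open>c\<close> is.\<close>

lemma revealed_first_copies:
  assumes "i \<le> k * h"
  shows "revealed (glued c) (order c) i = revealed (glued c') (order c') i"
proof -
  have same: "(\<exists>i<2 * k. u \<in> copy c i \<and> v \<in> copy c i) \<longleftrightarrow> u div h = v div h"
    if "u < k * h" "v < k * h" for u v c
  proof -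
    have rows: "u div h < k" "v div h < k" using that by (simp_all add: less_mult_imp_div_less)
    have "u div h = v div h" if i: "u \<in> copy c i" "v \<in> copy c i" for i
      using i rows by (simp add: copy_def row_def split: if_splits)
    moreover have "u \<in> copy c (u div h)" "v \<in> copy c (v div h)" using rows by (simp_all add: copy_first)
    moreover have "u div h < 2 * k" using rows(1) by simp
    ultimately show ?thesis by metis
  qed
  have arcs: "(u, v) \<in> parcs (glued c) \<longleftrightarrow> (u, v) \<in> parcs (glued c')"
    if "u < k * h" "v < k * h" for u v
  proof (cases "u = v")
    case False
    show ?thesis
      using first_copies_in_glued[OF that(1)] first_copies_in_glued[OF that(2)]
      by (simp add: glued_def same[OF that])
  qed (simp add: glued_def)
  have "take i (order c'') = [0..<i]" for c'' using assms by (simp add: order_prefix)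
  moreover have "{e \<in> parcs (glued c). fst e \<in> {0..<i} \<and> snd e \<in> {0..<i}} =
      {e \<in> parcs (glued c'). fst e \<in> {0..<i} \<and> snd e \<in> {0..<i}}"
    using arcs assms by auto
  ultimately show ?thesis
    by (simp add: revealed_def induce_subgraph_def with_proj_def)
qed

text \<open>With tapes agreeing on all bits that either run reads, both runs behave alike on the
  first copies. Their answers after step \<open>k * h\<close> coincide, and these are already the
  two sets of glue points.\<close>

lemma advice_determines_glue_points:
  assumes k: "1 \<le> k" and c: "\<And>j. j < k \<Longrightarrow> c j < h" "\<And>j. j < k \<Longrightarrow> c' j < h"
    and S: "alg_run A (glued c) (order c) \<phi> r S" "valid_solution H (glued c) (order c) S"
      "card (S (length (order c))) = opt H (glued c)"
    and S': "alg_run A (glued c') (order c') \<phi>' r' S'" "valid_solution H (glued c') (order c') S'"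
      "card (S' (length (order c'))) = opt H (glued c')"
    and m: "r (length (order c)) \<le> m" "r' (length (order c')) \<le> m" "stake m \<phi> = stake m \<phi>'"
    and j: "j < k"
  shows "c j = c' j"
proof -
  have take: "take i [0..<k * h] = take i (order c'')" if "i \<le> k * h" for i c''
    using that by (simp add: order_prefix)
  have rev: "revealed (glued c) [0..<k * h] i = revealed (glued c'') (order c'') i"
    if "i \<le> k * h" for i c''
    using revealed_first_copies[OF that, of c c''] take[OF that, of c] by (simp add: revealed_def)
  have len: "k * h \<le> length (order c'')" for c'' by (simp add: order_prefix)
  have "stake n \<phi> = stake n \<phi>'" if "n \<le> m" for n
    using m(3) that by (metis min.absorb1 take_stake)
  \<comment> \<open>\<open>alg_run\<close> does not ask the list to exhaust the graph, so both runs
    can be moved to the bare prefix, with one graph and one tape.\<close>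
  then have "alg_run A (glued c) [0..<k * h] \<phi> r S" "alg_run A (glued c) [0..<k * h] \<phi> r' S'"
    using take rev len m by (auto intro!: alg_run_transfer[OF S(1)] alg_run_transfer[OF S'(1)])
  then have "S (k * h) = S' (k * h)"
    using alg_run_unique[of A "glued c" "[0..<k * h]" \<phi> r S r' S' "k * h"] k h_pos by simp
  then have "glue_points c = glue_points c'"
    using optimal_answer_first_copies[OF k c(1) S(2,3)]
      optimal_answer_first_copies[OF k c(2) S'(2,3)] by simp
  moreover have "j * h + c j \<in> glue_points c" using j by (auto simp: glue_points_def)
  ultimately have "(j * h + c j) mod h = c' ((j * h + c j) div h)"
    using glue_points_iff[OF c(2)] by simp
  then show ?thesis using c(1)[OF j] by simp
qed

text \<open>Pigeonhole: the \<open>h ^ k\<close> choices of glue points need distinct tape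
  beginnings of length \<open>m\<close>, and there are only \<open>2 ^ m\<close> of these.\<close>

lemma advice_lower_bound:
  assumes k: "1 \<le> k"
    and sol: "\<And>c. solves_optimally H A (glued c) (order c) (\<phi> c)"
  shows "\<exists>c n. opt H (glued c) = k \<and> reads_bits A (glued c) (order c) (\<phi> c) n \<and> h ^ k \<le> 2 ^ n"
proof -
  \<comment> \<open>Extensional functions, so that agreement below \<open>k\<close> means
    equality.\<close>
  define F where "F = {..<k} \<rightarrow>\<^sub>E {..<h}"
  have F: "finite F" "card F = h ^ k" "F \<noteq> {}"
    using h_pos by (auto simp: F_def finite_PiE card_PiE PiE_eq_empty_iff)
  have Fc: "c j < h" if "c \<in> F" "j < k" for c j using that by (auto simp: F_def PiE_iff)
  obtain r S where rS: "\<And>c. alg_run A (glued c) (order c) (\<phi> c) (r c) (S c)"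
    "\<And>c. valid_solution H (glued c) (order c) (S c)"
    "\<And>c. card (S c (length (order c))) = opt H (glued c)"
    using sol unfolding solves_optimally_def by metis
  define n where "n c = r c (length (order c))" for c
  \<comment> \<open>Taking the maximum lets tapes be compared at one common length, and an instance
    attaining it is the witness.\<close>
  define m where "m = Max (n ` F)"
  have "m \<in> n ` F" unfolding m_def using F(1,3) by (intro Max_in) simp_all
  then obtain c where cF: "c \<in> F" and cm: "n c = m" by blast
  have "inj_on (\<lambda>c. stake m (\<phi> c)) F"
  proof (rule inj_onI)
    fix c c' assume c: "c \<in> F" "c' \<in> F" "stake m (\<phi> c) = stake m (\<phi> c')"
    have le: "n c \<le> m" "n c' \<le> m" using c F(1) by (auto simp: m_def)
    have "c j = c' j" if "j < k" for j
      using advice_determines_glue_points[OF k Fc[OF c(1)] Fc[OF c(2)] rS rS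
          le(1)[unfolded n_def] le(2)[unfolded n_def] c(3) that] .
    then show "c = c'" using c(1,2) by (auto simp: F_def intro: PiE_ext)
  qed
  moreover have "(\<lambda>c. stake m (\<phi> c)) ` F \<subseteq> {xs. set xs \<subseteq> UNIV \<and> length xs = m}" by auto
  moreover have "finite {xs. set xs \<subseteq> (UNIV :: bool set) \<and> length xs = m}"
    by (rule finite_lists_length_eq) simp
  ultimately have "card F \<le> card {xs. set xs \<subseteq> (UNIV :: bool set) \<and> length xs = m}"
    by (rule card_inj_on_le)
  also have "\<dots> = 2 ^ m" by (subst card_lists_length_eq) (simp_all add: card_UNIV_bool)
  finally have "h ^ k \<le> 2 ^ n c" using F(2) cm by simp
  moreover have "reads_bits A (glued c) (order c) (\<phi> c) (n c)"
    using rS(1) by (auto simp: reads_bits_def n_def)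
  moreover have "opt H (glued c) = k" using opt_glued Fc[OF cF] by blast
  ultimately show ?thesis by blast
qed

end

theorem corollary1:
  fixes H :: "'a pair_pre_digraph"
  assumes "pair_graph H" and "pverts H \<noteq> {}"
  shows "requires_advice H (\<lambda>k. real k * log 2 (real (card (pverts H))))"
  unfolding requires_advice_def
proof (intro allI impI)
  fix A and \<phi> :: "nat pair_pre_digraph \<Rightarrow> nat list \<Rightarrow> bool stream" and k :: nat
  assume sol: "\<forall>G vs. online_instance G vs \<longrightarrow> solves_optimally H A G vs (\<phi> G vs)" and k: "1 \<le> k"
  define h where "h = card (pverts H)"
  have fin: "finite (pverts H)"
    using assms(1) by (simp add: pair_graph_def pair_digraph_def pair_fin_digraph_def pair_fin_digraph_axioms_def)
  obtain g where g: "bij_betw g {..<h} (pverts H)"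
    using ex_bij_betw_nat_finite[OF fin] by (auto simp: h_def atLeast0LessThan)
  have symH: "(y, x) \<in> parcs H" if "(x, y) \<in> parcs H" for x y
    using that pair_sym_digraph.pair_sym_arcs[of H] assms(1)
    by (auto simp: symmetric_def sym_def pair_graph_def pair_pseudo_graph_def)
  obtain d where d: "\<forall>X. X \<subseteq> pverts H \<longrightarrow> X \<noteq> {} \<longrightarrow> X \<noteq> pverts H \<longrightarrow>
      (\<exists>x \<in> X. \<exists>y \<in> pverts H - X. ((x, y) \<in> parcs H) \<noteq> d)"
    using connected_or_complement_connected[of "\<lambda>x y. (x, y) \<in> parcs H" "pverts H"] symH by blast
  have h: "0 < h" using fin assms(2) by (simp add: h_def card_gt_0_iff)
  interpret gluing H g h k d
    by (rule gluing.intro[OF assms(1) g h]) (rule d[rule_format])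
  have "solves_optimally H A (glued c) (order c) (\<phi> (glued c) (order c))" for c
    using sol online_instance_glued[OF k] by blast
  then obtain c n where c: "opt H (glued c) = k"
    "reads_bits A (glued c) (order c) (\<phi> (glued c) (order c)) n" "h ^ k \<le> 2 ^ n"
    using advice_lower_bound[OF k, of A "\<lambda>c. \<phi> (glued c) (order c)"] by blast
  have "real k * log 2 (real h) = log 2 (real (h ^ k))" using h by (simp add: log_nat_power)
  also have "\<dots> \<le> log 2 (real (2 ^ n))"
  proof (rule log_mono)
    show "real (h ^ k) \<le> real (2 ^ n)" using c(3) by (simp only: of_nat_le_iff)
  qed (use h in simp_all)
  also have "\<dots> = real n" by (simp add: log_nat_power)
  finally show "\<exists>G vs n. online_instance G vs \<and> opt H G = k \<and> reads_bits A G vs (\<phi> G vs) n \<and>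
      real k * log 2 (real (card (pverts H))) \<le> real n"
    using c online_instance_glued[OF k] unfolding h_def by blast
qed

end
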